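(* Assume the smoothness assumption stated in the context (compact sets $K,K_x$ and bound $B_\psi$). Then there exists a constant $C<\infty$, depending only on $B_\psi$ and $L$, such that for every integer $N\ge 1$ $$0\;\le\;\inf_{\omega_1,\ldots,\omega_N\in K}\mathcal E_N(\omega_1,\ldots,\omega_N)-\inf_{\rho\in\mathcal P(K)}\mathcal E(\rho)\;\le\;\frac{C}{\sqrt N}.$$
   Context: Model. Fix positive integers $L,d_x,d_k,d_v$ and a fixed matrix $W_{\mathrm{out}}\in\mathbb R^{d_x\times d_v}$. A head parameter is $\omega=(W_Q,W_K,W_V,W_O)\in\mathbb R^{d_x\times d_k}\times\mathbb R^{d_x\times d_k}\times\mathbb R^{d_x\times d_k}\times\mathbb R^{d_k\times d_x}$, identified with a vector in $\mathbb R^{d_\omega}$. For an input $X\in\mathbb R^{L\times d_x}$ (rows are tokens), the causally masked attention matrix $A_\omega(X)\in\mathbb R^{L\times L}$ has entries $$A_\omega(X)_{rs}=\frac{\exp\big((XW_QW_K^\top X^\top)_{rs}/\sqrt{d_k}\big)}{\sum_{s'\le r}\exp\big((XW_QW_K^\top X^\top)_{rs'}/\sqrt{d_k}\big)}\ (s\le r),\qquad A_\omega(X)_{rs}=0\ (s>r).$$ $\psi_l(X;\omega)\in\mathbb R^{d_v}$ is the $l$-th row of $A_\omega(X)XW_VW_OW_{\mathrm{out}}$, $l=1,\dots,L$. Data and risk. $X$ is a random input and $Y_l(X)\in\mathbb R^{d_v}$ is a one-hot label for each $l$; $\mathbb E_X$ is expectation over $X$. $\mathrm{softmax}_j(z)=e^{z_j}/\sum_m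 e^{z_m}$. For a probability measure $\rho$ on $\mathbb R^{d_\omega}$, $z_l^\rho(X)=\int\psi_l(X;\omega)\,\rho(d\omega)$. The cross-entropy loss is $\ell(y,z)=\log\big(\sum_{j=1}^{d_v}e^{z_j}\big)-y^\top z$, and the risk is $\mathcal E(\rho)=\mathbb E_X\big[\frac1L\sum_{l=1}^L\ell(Y_l(X),z_l^\rho(X))\big]$. The $N$-head risk is $\mathcal E_N(\omega_1,\ldots,\omega_N)=\mathcal E\big(\frac1N\sum_{i=1}^N\delta_{\omega_i}\big)$. $\mathcal P(K)$ is the set of Borel probability measures on $K$. Smoothness assumption. $K\subset\mathbb R^{d_\omega}$ and $K_x\subset\mathbb R^{d_x}$ are compact, all measures considered are supported in $K$, all input tokens lie in $K_x$ (so $X\in K_x^L$), the maps $\omega\mapsto\psi_l(X;\omega)$ are $C^3$ on $K$ for all $l$ and almost every $X$, and there is $B_\psi<\infty$ with $$\sup_{X\in K_x^L,\,1\le l\le L,\,\omega\in K}\big(\|\psi_l(X;\omega)\|+\|\nabla_\omega\psi_l(X;\omega)\|+\|\nabla^2_\omega\psi_l(X;\omega)\|+\|\nabla^3_\omega\psi_l(X;\omega)\|\big)\le B_\psi.$$ *)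

theory Defs
  imports "HOL-Probability.Probability" "Jordan_Normal_Form.Matrix"
begin

text \<open>
  All dimensions are natural numbers rather than index types, so that a statement can assert that
  a constant is independent of them. Points of \<open>\<real>\<^sup>n\<close>, as far as topology and calculus are
  concerned, are functions of type \<^typ>\<open>nat \<Rightarrow> real\<close> vanishing from \<open>n\<close> on
  (the library's \<^const>\<open>Euclidean_space\<close>); matrices and output vectors are those of
  Jordan-Normal-Form. Matrix rows, coordinates, tokens and heads are numbered from 0.
\<close>

unbundle no vec_syntax

section \<open>The attention model\<close>

definition param_dim :: "nat \<Rightarrow> nat \<Rightarrow> nat" where
  "param_dim dx dk = 3 * (dx * dk) + dk * dx"

text \<open>A head parameter is the concatenation of the row-major entries of
  \<open>W\<^sub>Q, W\<^sub>K, W\<^sub>V\<close> (each \<open>dx \<times> dk\<close>) and \<open>W\<^sub>O\<close> (\<open>dk \<times> dx\<close>).\<close>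

definition W_Q :: "nat \<Rightarrow> nat \<Rightarrow> (nat \<Rightarrow> real) \<Rightarrow> real mat" where
  "W_Q dx dk w = mat dx dk (\<lambda>(i, j). w (i * dk + j))"

definition W_K :: "nat \<Rightarrow> nat \<Rightarrow> (nat \<Rightarrow> real) \<Rightarrow> real mat" where
  "W_K dx dk w = mat dx dk (\<lambda>(i, j). w (dx * dk + (i * dk + j)))"

definition W_V :: "nat \<Rightarrow> nat \<Rightarrow> (nat \<Rightarrow> real) \<Rightarrow> real mat" where
  "W_V dx dk w = mat dx dk (\<lambda>(i, j). w (2 * (dx * dk) + (i * dk + j)))"

definition W_O :: "nat \<Rightarrow> nat \<Rightarrow> (nat \<Rightarrow> real) \<Rightarrow> real mat" where
  "W_O dx dk w = mat dk dx (\<lambda>(i, j). w (3 * (dx * dk) + (i * dx + j)))"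

text \<open>An input assigns to each position \<open>l < L\<close> a token \<open>X l\<close>, a point of \<open>\<real>\<^sup>d\<^sup>x\<close>.\<close>

definition input_mat :: "nat \<Rightarrow> nat \<Rightarrow> (nat \<Rightarrow> nat \<Rightarrow> real) \<Rightarrow> real mat" where
  "input_mat L dx X = mat L dx (\<lambda>(l, i). X l i)"

definition score_mat ::
  "nat \<Rightarrow> nat \<Rightarrow> nat \<Rightarrow> (nat \<Rightarrow> nat \<Rightarrow> real) \<Rightarrow> (nat \<Rightarrow> real) \<Rightarrow> real mat" where
  "score_mat L dx dk X w =
     input_mat L dx X * W_Q dx dk w * transpose_mat (W_K dx dk w) * transpose_mat (input_mat L dx X)"

definition attention_mat ::
  "nat \<Rightarrow> nat \<Rightarrow> nat \<Rightarrow> (nat \<Rightarrow> nat \<Rightarrow> real) \<Rightarrow> (nat \<Rightarrow> real) \<Rightarrow> real mat" where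
  "attention_mat L dx dk X w = mat L L (\<lambda>(r, s).
     if s \<le> r
     then exp (score_mat L dx dk X w $$ (r, s) / sqrt (real dk)) /
          (\<Sum>s'\<le>r. exp (score_mat L dx dk X w $$ (r, s') / sqrt (real dk)))
     else 0)"

definition head_output ::
  "nat \<Rightarrow> nat \<Rightarrow> nat \<Rightarrow> real mat \<Rightarrow> nat \<Rightarrow> (nat \<Rightarrow> nat \<Rightarrow> real) \<Rightarrow> (nat \<Rightarrow> real) \<Rightarrow> real vec" where
  "head_output L dx dk Wout l X w =
     row (attention_mat L dx dk X w * input_mat L dx X * W_V dx dk w * W_O dx dk w * Wout) l"

section \<open>Data and risk\<close>

definition prob_measures_on :: "(nat \<Rightarrow> real) set \<Rightarrow> (nat \<Rightarrow> real) measure set" where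
  "prob_measures_on K = {\<rho>. prob_space \<rho> \<and> sets \<rho> = sets (restrict_space borel K)}"

definition mean_output ::
  "nat \<Rightarrow> nat \<Rightarrow> nat \<Rightarrow> nat \<Rightarrow> real mat \<Rightarrow> (nat \<Rightarrow> real) measure \<Rightarrow> nat \<Rightarrow> (nat \<Rightarrow> nat \<Rightarrow> real) \<Rightarrow> real vec"
  where
  "mean_output L dx dk dv Wout \<rho> l X =
     vec dv (\<lambda>j. \<integral>w. head_output L dx dk Wout l X w $ j \<partial>\<rho>)"

definition cross_entropy :: "nat \<Rightarrow> real vec \<Rightarrow> real vec \<Rightarrow> real" where
  "cross_entropy dv y z = ln (\<Sum>j<dv. exp (z $ j)) - scalar_prod y z"

text \<open>\<open>\<mu>\<close> is the law of the random input and \<open>Y l X\<close> the label at position \<open>l\<close>.\<close>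

definition risk ::
  "nat \<Rightarrow> nat \<Rightarrow> nat \<Rightarrow> nat \<Rightarrow> real mat \<Rightarrow> (nat \<Rightarrow> nat \<Rightarrow> real) measure \<Rightarrow>
   (nat \<Rightarrow> (nat \<Rightarrow> nat \<Rightarrow> real) \<Rightarrow> real vec) \<Rightarrow> (nat \<Rightarrow> real) measure \<Rightarrow> real" where
  "risk L dx dk dv Wout \<mu> Y \<rho> =
     (\<integral>X. 1 / real L * (\<Sum>l<L. cross_entropy dv (Y l X) (mean_output L dx dk dv Wout \<rho> l X)) \<partial>\<mu>)"

definition empirical_measure ::
  "(nat \<Rightarrow> real) set \<Rightarrow> nat \<Rightarrow> (nat \<Rightarrow> nat \<Rightarrow> real) \<Rightarrow> (nat \<Rightarrow> real) measure" where
  "empirical_measure K N w =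
     measure_of K (sets (restrict_space borel K))
       (\<lambda>A. (\<Sum>i<N. emeasure (return (restrict_space borel K) (w i)) A) / of_nat N)"

lemma emeasure_empirical_measure:
  assumes A: "A \<in> sets (restrict_space borel K)"
  shows "emeasure (empirical_measure K N w) A =
    (\<Sum>i<N. emeasure (return (restrict_space borel K) (w i)) A) / of_nat N"
proof (rule emeasure_measure_of[OF empirical_measure_def])
  let ?R = "restrict_space borel K"
  let ?f = "\<lambda>A. (\<Sum>i<N. emeasure (return ?R (w i)) A) / (of_nat N :: ennreal)"
  show "sets ?R \<subseteq> Pow K"
    using sets.sets_into_space[of _ ?R] by (auto simp: space_restrict_space)
  have [simp]: "sets (empirical_measure K N w) = sets ?R"
    unfolding empirical_measure_def
    using sets.sets_measure_of_eq[of ?R] by (simp add: space_restrict_space)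
  show "A \<in> sets (empirical_measure K N w)"
    using A by simp
  show "positive (sets (empirical_measure K N w)) ?f"
    by (simp add: positive_def)
  show "countably_additive (sets (empirical_measure K N w)) ?f"
  proof (simp, rule countably_additiveI)
    fix B :: "nat \<Rightarrow> (nat \<Rightarrow> real) set"
    assume B: "range B \<subseteq> sets ?R" "disjoint_family B"
    have *: "(\<Sum>n. emeasure (return ?R (w i)) (B n)) = emeasure (return ?R (w i)) (\<Union>n. B n)" for i
      using B by (intro suminf_emeasure) auto
    show "(\<Sum>n. ?f (B n)) = ?f (\<Union>n. B n)"
      by (simp add: divide_ennreal_def suminf_sum *)
  qed
qed

definition N_head_risk ::
  "nat \<Rightarrow> nat \<Rightarrow> nat \<Rightarrow> nat \<Rightarrow> real mat \<Rightarrow> (nat \<Rightarrow> nat \<Rightarrow> real) measure \<Rightarrow>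
   (nat \<Rightarrow> (nat \<Rightarrow> nat \<Rightarrow> real) \<Rightarrow> real vec) \<Rightarrow> (nat \<Rightarrow> real) set \<Rightarrow> nat \<Rightarrow> (nat \<Rightarrow> nat \<Rightarrow> real) \<Rightarrow> real"
  where
  "N_head_risk L dx dk dv Wout \<mu> Y K N w = risk L dx dk dv Wout \<mu> Y (empirical_measure K N w)"

definition data_model ::
  "nat \<Rightarrow> nat \<Rightarrow> (nat \<Rightarrow> real) set \<Rightarrow> (nat \<Rightarrow> nat \<Rightarrow> real) measure \<Rightarrow>
   (nat \<Rightarrow> (nat \<Rightarrow> nat \<Rightarrow> real) \<Rightarrow> real vec) \<Rightarrow> bool" where
  "data_model L dv Kx \<mu> Y \<longleftrightarrow>
     prob_space \<mu> \<and> sets \<mu> = sets (Pi\<^sub>M {..<L} (\<lambda>_. restrict_space borel Kx)) \<and>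
     (\<forall>l<L. (\<forall>X\<in>space \<mu>. \<exists>j<dv. Y l X = unit_vec dv j) \<and>
            (\<forall>j<dv. (\<lambda>X. Y l X $ j) \<in> borel_measurable \<mu>))"

section \<open>Smoothness\<close>

definition dir_deriv :: "(nat \<Rightarrow> real) \<Rightarrow> ((nat \<Rightarrow> real) \<Rightarrow> real) \<Rightarrow> (nat \<Rightarrow> real) \<Rightarrow> real" where
  "dir_deriv h f w = deriv (\<lambda>t. f (\<lambda>i. w i + t * h i)) 0"

definition basis_dir :: "nat \<Rightarrow> nat \<Rightarrow> real" where
  "basis_dir i = (\<lambda>j. if j = i then 1 else 0)"

text \<open>\<open>C\<^sup>k\<close> on an open subset \<open>U\<close> of \<open>\<real>\<^sup>n\<close>: partial derivatives up to order \<open>k\<close> exist and are continuous.\<close>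

fun Ck_on_open :: "nat \<Rightarrow> nat \<Rightarrow> (nat \<Rightarrow> real) set \<Rightarrow> ((nat \<Rightarrow> real) \<Rightarrow> real) \<Rightarrow> bool" where
  "Ck_on_open 0 n U f \<longleftrightarrow> continuous_map (subtopology (Euclidean_space n) U) euclideanreal f"
| "Ck_on_open (Suc k) n U f \<longleftrightarrow>
     continuous_map (subtopology (Euclidean_space n) U) euclideanreal f \<and>
     (\<forall>i<n. (\<forall>w\<in>U. (\<lambda>t. f (\<lambda>j. w j + t * basis_dir i j)) field_differentiable at 0) \<and>
            Ck_on_open k n U (dir_deriv (basis_dir i) f))"

text \<open>\<open>C\<^sup>k\<close> on an arbitrary set \<open>K\<close> means \<open>C\<^sup>k\<close> on an open neighbourhood of \<open>K\<close>.\<close>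

definition Ck_on :: "nat \<Rightarrow> nat \<Rightarrow> nat \<Rightarrow> (nat \<Rightarrow> real) set \<Rightarrow> ((nat \<Rightarrow> real) \<Rightarrow> real vec) \<Rightarrow> bool" where
  "Ck_on k n m K F \<longleftrightarrow>
     (\<exists>U. openin (Euclidean_space n) U \<and> K \<subseteq> U \<and> (\<forall>j<m. Ck_on_open k n U (\<lambda>w. F w $ j)))"

text \<open>Operator norm of the \<open>k\<close>-th derivative of \<open>F : \<real>\<^sup>n \<rightarrow> \<real>\<^sup>m\<close> at \<open>w\<close>, as a \<open>k\<close>-linear map:
  the supremum of \<open>\<parallel>\<nabla>\<^sup>kF(w)[h\<^sub>1,\<dots>,h\<^sub>k]\<parallel>\<close> over directions of Euclidean norm at most 1
  (extended-real valued, so that no boundedness is presupposed).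
  For \<open>k = 0\<close> it is the Euclidean norm of \<open>F w\<close>.\<close>

definition deriv_norm :: "nat \<Rightarrow> nat \<Rightarrow> nat \<Rightarrow> ((nat \<Rightarrow> real) \<Rightarrow> real vec) \<Rightarrow> (nat \<Rightarrow> real) \<Rightarrow> ereal" where
  "deriv_norm k n m F w =
     (SUP hs \<in> {hs. length hs = k \<and>
                   (\<forall>h\<in>set hs. h \<in> topspace (Euclidean_space n) \<and> L2_set h {..<n} \<le> 1)}.
        ereal (L2_set (\<lambda>j. foldr dir_deriv hs (\<lambda>v. F v $ j) w) {..<m}))"

definition smoothness_assumption ::
  "nat \<Rightarrow> nat \<Rightarrow> nat \<Rightarrow> nat \<Rightarrow> real mat \<Rightarrow> (nat \<Rightarrow> real) set \<Rightarrow> (nat \<Rightarrow> real) set \<Rightarrow>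
   (nat \<Rightarrow> nat \<Rightarrow> real) measure \<Rightarrow> real \<Rightarrow> bool" where
  "smoothness_assumption L dx dk dv Wout K Kx \<mu> B \<longleftrightarrow>
     compactin (Euclidean_space (param_dim dx dk)) K \<and>
     compactin (Euclidean_space dx) Kx \<and>
     (AE X in \<mu>. \<forall>l<L. Ck_on 3 (param_dim dx dk) dv K (head_output L dx dk Wout l X)) \<and>
     (\<forall>X \<in> PiE {..<L} (\<lambda>_. Kx). \<forall>l<L. \<forall>w\<in>K.
        (\<Sum>k\<le>3. deriv_norm k (param_dim dx dk) dv (head_output L dx dk Wout l X) w) \<le> ereal B)"

end

(*
  Maurey's empirical method, derandomised. Given rho, the heads are chosen one after the other so
  that the sum of the centred outputs psi(w_i) - z^rho stays small in L^2 of the data: averaging the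
  next head over rho kills the cross term (Fubini), so some choice increases the squared norm by at
  most L B^2. After N steps the mean output of the heads is at squared distance at most L B^2 / N
  from z^rho, and the cross-entropy with a one-hot label is 2-Lipschitz in the logits (sup norm).
  The lower bound holds because empirical measures on K are probability measures on K.
*)
theory Submission
  imports Defs
begin

section \<open>Greedy choice of sampling points\<close>

text \<open>If \<open>g\<close> exceeded its mean everywhere, integrating the strict inequality over
  a space of mass 1 would put the mean strictly below itself. This turns an average over random
  heads into the choice of one head.\<close>

lemma (in prob_space) exists_le_expectation:
  fixes g :: "'a \<Rightarrow> real"
  assumes "integrable M g"
  shows "\<exists>w\<in>space M. g w \<le> expectation g"
proof (rule ccontr)
  assume "\<not> ?thesis"
  then have *: "\<And>w. w \<in> space M \<Longrightarrow> expectation g < g w" by auto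
  have "(\<integral>w. expectation g \<partial>M) < (\<integral>w. g w \<partial>M)"
  proof (rule integral_less_AE_space)
    show "emeasure M (space M) \<noteq> 0" by (simp add: emeasure_space_1)
    show "AE w in M. expectation g < g w" using * by (intro AE_I2)
  qed (use assms in auto)
  then show False by (simp add: prob_space)
qed

lemma (in prob_space) abs_expectation_le:
  fixes g :: "'a \<Rightarrow> real"
  assumes "g \<in> borel_measurable M" "\<And>w. w \<in> space M \<Longrightarrow> \<bar>g w\<bar> \<le> c"
  shows "\<bar>expectation g\<bar> \<le> c"
proof -
  have "integrable M g"
    using assms by (intro integrable_const_bound[where B=c]) auto
  then have "(\<integral>w. \<bar>g w\<bar> \<partial>M) \<le> (\<integral>w. c \<partial>M)"
    using assms by (intro integral_mono) auto
  then show ?thesis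
    using order_trans[OF integral_abs_bound, of M g c] by (simp add: prob_space)
qed

text \<open>Averaged over \<open>w\<close>, the deviation of \<open>f j x w\<close> from its mean
  vanishes, so the expected square grows only by the variance, which is at most the second moment
  and hence, summed over \<open>J\<close>, at most \<open>D\<close>. Some \<open>w\<close> does at
  least as well as the average. The bounds \<open>c\<close> and \<open>c'\<close> provide
  integrability, while \<open>D\<close> alone enters the estimate.\<close>

lemma greedy_step:
  fixes f :: "'j \<Rightarrow> 'x \<Rightarrow> 'w \<Rightarrow> real"
  assumes "prob_space \<mu>" "prob_space \<rho>" "finite J"
    and meas: "\<And>j. j \<in> J \<Longrightarrow> (\<lambda>(x, w). f j x w) \<in> borel_measurable (\<mu> \<Otimes>\<^sub>M \<rho>)"
    and bnd: "\<And>j x w. j \<in> J \<Longrightarrow> x \<in> space \<mu> \<Longrightarrow> w \<in> space \<rho> \<Longrightarrow> \<bar>f j x w\<bar> \<le> c"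
    and sq: "\<And>x w. x \<in> space \<mu> \<Longrightarrow> w \<in> space \<rho> \<Longrightarrow> (\<Sum>j\<in>J. (f j x w)\<^sup>2) \<le> D"
    and S_meas: "\<And>j. j \<in> J \<Longrightarrow> S j \<in> borel_measurable \<mu>"
    and S_bnd: "\<And>j x. j \<in> J \<Longrightarrow> x \<in> space \<mu> \<Longrightarrow> \<bar>S j x\<bar> \<le> c'"
  shows "\<exists>w\<in>space \<rho>. (\<integral>x. (\<Sum>j\<in>J. (S j x + (f j x w - (\<integral>v. f j x v \<partial>\<rho>)))\<^sup>2) \<partial>\<mu>)
    \<le> (\<integral>x. (\<Sum>j\<in>J. (S j x)\<^sup>2) \<partial>\<mu>) + D"
proof -
  interpret \<mu>: prob_space \<mu> by fact
  interpret \<rho>: prob_space \<rho> by fact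
  interpret P: pair_prob_space \<mu> \<rho> ..
  define z where "z j x = (\<integral>v. f j x v \<partial>\<rho>)" for j x
  define h where "h j = (\<lambda>(x, w). (S j x + (f j x w - z j x))\<^sup>2)" for j
  have f_w: "f j x \<in> borel_measurable \<rho>" if "j \<in> J" "x \<in> space \<mu>" for j x
    using measurable_compose[OF measurable_Pair1'[OF that(2)] meas[OF that(1)]] by simp
  have f_int: "integrable \<rho> (f j x)" if "j \<in> J" "x \<in> space \<mu>" for j x
    by (rule \<rho>.integrable_const_bound[where B=c]) (use that bnd f_w in auto)
  have f2_int: "integrable \<rho> (\<lambda>w. (f j x w)\<^sup>2)" if "j \<in> J" "x \<in> space \<mu>" for j x
  proof (rule \<rho>.integrable_const_bound[where B="c\<^sup>2"])
    show "AE w in \<rho>. norm ((f j x w)\<^sup>2) \<le> c\<^sup>2"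
      using bnd[OF that] by (intro AE_I2) (simp add: abs_le_square_iff[symmetric] order_trans[OF bnd[OF that] abs_ge_self])
  qed (use f_w[OF that] in measurable)
  have z_meas: "z j \<in> borel_measurable \<mu>" if "j \<in> J" for j
    unfolding z_def using meas[OF that] by (rule \<rho>.borel_measurable_lebesgue_integral)
  have z_bnd: "\<bar>z j x\<bar> \<le> c" if "j \<in> J" "x \<in> space \<mu>" for j x
    unfolding z_def using f_w bnd that by (intro \<rho>.abs_expectation_le) auto
  have h_int: "integrable (\<mu> \<Otimes>\<^sub>M \<rho>) (h j)" if "j \<in> J" for j
  proof (rule P.integrable_const_bound[where B="(c' + (c + c))\<^sup>2"])
    show "AE p in \<mu> \<Otimes>\<^sub>M \<rho>. norm (h j p) \<le> (c' + (c + c))\<^sup>2"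
    proof (rule AE_I2)
      fix p assume "p \<in> space (\<mu> \<Otimes>\<^sub>M \<rho>)"
      then obtain x w where p: "p = (x, w)" "x \<in> space \<mu>" "w \<in> space \<rho>"
        by (auto simp: space_pair_measure)
      have "\<bar>S j x + (f j x w - z j x)\<bar> \<le> \<bar>c' + (c + c)\<bar>"
        using S_bnd[OF that p(2)] bnd[OF that p(2,3)] z_bnd[OF that p(2)] by linarith
      then show "norm (h j p) \<le> (c' + (c + c))\<^sup>2"
        by (simp add: h_def p abs_le_square_iff)
    qed
    note [measurable] = S_meas[OF that] meas[OF that] z_meas[OF that]
    show "h j \<in> borel_measurable (\<mu> \<Otimes>\<^sub>M \<rho>)"
      unfolding h_def by measurable
  qed
  \<comment> \<open>\<open>G\<close> is the squared norm at the data point \<open>x\<close> after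
    adding the head \<open>w\<close>. Integrating it over \<open>x\<close> gives the quantity to be
    kept small, integrating it over \<open>w\<close> first makes the cross term disappear.\<close>
  define G where "G = (\<lambda>(x, w). \<Sum>j\<in>J. h j (x, w))"
  have G_int: "integrable (\<mu> \<Otimes>\<^sub>M \<rho>) G"
    unfolding G_def using h_int by (auto simp: case_prod_unfold)
  have inner: "(\<integral>w. G (x, w) \<partial>\<rho>) \<le> (\<Sum>j\<in>J. (S j x)\<^sup>2) + D" if x: "x \<in> space \<mu>" for x
  proof -
    have one: "integrable \<rho> (\<lambda>w. h j (x, w)) \<and>
        (\<integral>w. h j (x, w) \<partial>\<rho>) \<le> (S j x)\<^sup>2 + (\<integral>w. (f j x w)\<^sup>2 \<partial>\<rho>)" if j: "j \<in> J" for j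
    proof -
      \<comment> \<open>Sorting by powers of \<open>f j x w\<close> makes the coefficients constant
        in \<open>w\<close>, so the integral involves only the first two moments.\<close>
      have eq: "(\<lambda>w. h j (x, w)) = (\<lambda>w. (f j x w)\<^sup>2 + 2 * (S j x - z j x) * f j x w + (S j x - z j x)\<^sup>2)"
        by (auto simp: h_def power2_eq_square algebra_simps)
      have "(\<integral>w. h j (x, w) \<partial>\<rho>) =
          (\<integral>w. (f j x w)\<^sup>2 \<partial>\<rho>) + 2 * (S j x - z j x) * z j x + (S j x - z j x)\<^sup>2"
        unfolding eq using f_int[OF j x] f2_int[OF j x] by (simp add: z_def \<rho>.prob_space)
      \<comment> \<open>The terms mixing \<open>S\<close> and \<open>z\<close> cancel. What is added
        to the square of \<open>S\<close> is the variance, and its negative part is then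
        dropped.\<close>
      also have "\<dots> = (S j x)\<^sup>2 + (\<integral>w. (f j x w)\<^sup>2 \<partial>\<rho>) - (z j x)\<^sup>2"
        by (simp add: power2_eq_square algebra_simps)
      finally show ?thesis
        unfolding eq using f_int[OF j x] f2_int[OF j x] by simp
    qed
    have "(\<integral>w. G (x, w) \<partial>\<rho>) = (\<Sum>j\<in>J. \<integral>w. h j (x, w) \<partial>\<rho>)"
      unfolding G_def using one by simp
    also have "\<dots> \<le> (\<Sum>j\<in>J. (S j x)\<^sup>2 + (\<integral>w. (f j x w)\<^sup>2 \<partial>\<rho>))"
      using one by (intro sum_mono) auto
    also have "\<dots> = (\<Sum>j\<in>J. (S j x)\<^sup>2) + (\<integral>w. (\<Sum>j\<in>J. (f j x w)\<^sup>2) \<partial>\<rho>)"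
      using f2_int x by (simp add: sum.distrib)
    also have "(\<integral>w. (\<Sum>j\<in>J. (f j x w)\<^sup>2) \<partial>\<rho>) \<le> (\<integral>w. D \<partial>\<rho>)"
      using f2_int x sq by (intro integral_mono) auto
    finally show ?thesis by (simp add: \<rho>.prob_space)
  qed
  have S2_int: "integrable \<mu> (\<lambda>x. \<Sum>j\<in>J. (S j x)\<^sup>2)"
  proof (intro Bochner_Integration.integrable_sum \<mu>.integrable_const_bound[where B="c'\<^sup>2"] AE_I2)
    fix j x assume "j \<in> J" "x \<in> space \<mu>"
    then show "norm ((S j x)\<^sup>2) \<le> c'\<^sup>2"
      using S_bnd[of j x] by (simp add: abs_le_square_iff[symmetric])
  qed (use S_meas in measurable)
  obtain w where w: "w \<in> space \<rho>" "(\<integral>x. G (x, w) \<partial>\<mu>) \<le> (\<integral>w. (\<integral>x. G (x, w) \<partial>\<mu>) \<partial>\<rho>)"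
    using \<rho>.exists_le_expectation[OF P.integrable_snd[of "\<lambda>x w. G (x, w)"]] G_int by auto
  note w(2)
  also have "(\<integral>w. (\<integral>x. G (x, w) \<partial>\<mu>) \<partial>\<rho>) = (\<integral>x. (\<integral>w. G (x, w) \<partial>\<rho>) \<partial>\<mu>)"
    using G_int by (intro P.Fubini_integral) simp
  also have "\<dots> \<le> (\<integral>x. (\<Sum>j\<in>J. (S j x)\<^sup>2) + D \<partial>\<mu>)"
    using P.integrable_fst[of "\<lambda>x w. G (x, w)"] G_int inner S2_int by (intro integral_mono) auto
  also have "\<dots> = (\<integral>x. (\<Sum>j\<in>J. (S j x)\<^sup>2) \<partial>\<mu>) + D"
    using S2_int by (simp add: \<mu>.prob_space)
  finally show ?thesis
    using w(1) by (auto simp: G_def h_def z_def)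
qed

text \<open>Induction on \<open>N\<close>: each new point is chosen after the previous ones and
  costs at most \<open>D\<close>. The bound is therefore linear in \<open>N\<close>, as for sums of
  independent centred variables.\<close>

lemma greedy_sampling:
  fixes f :: "'j \<Rightarrow> 'x \<Rightarrow> 'w \<Rightarrow> real"
  assumes "prob_space \<mu>" "prob_space \<rho>" "finite J"
    and meas: "\<And>j. j \<in> J \<Longrightarrow> (\<lambda>(x, w). f j x w) \<in> borel_measurable (\<mu> \<Otimes>\<^sub>M \<rho>)"
    and bnd: "\<And>j x w. j \<in> J \<Longrightarrow> x \<in> space \<mu> \<Longrightarrow> w \<in> space \<rho> \<Longrightarrow> \<bar>f j x w\<bar> \<le> c"
    and sq: "\<And>x w. x \<in> space \<mu> \<Longrightarrow> w \<in> space \<rho> \<Longrightarrow> (\<Sum>j\<in>J. (f j x w)\<^sup>2) \<le> D"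
  shows "\<exists>w. (\<forall>i<N. w i \<in> space \<rho>) \<and>
    (\<integral>x. (\<Sum>j\<in>J. (\<Sum>i<N. f j x (w i) - (\<integral>v. f j x v \<partial>\<rho>))\<^sup>2) \<partial>\<mu>) \<le> real N * D"
proof (induction N)
  case 0
  then show ?case by simp
next
  case (Suc N)
  interpret \<rho>: prob_space \<rho> by fact
  define z where "z j x = (\<integral>v. f j x v \<partial>\<rho>)" for j x
  from Suc obtain w where w: "\<And>i. i < N \<Longrightarrow> w i \<in> space \<rho>"
    and le: "(\<integral>x. (\<Sum>j\<in>J. (\<Sum>i<N. f j x (w i) - z j x)\<^sup>2) \<partial>\<mu>) \<le> real N * D"
    by (auto simp: z_def)
  have z_bnd: "\<bar>z j x\<bar> \<le> c" if "j \<in> J" "x \<in> space \<mu>" for j x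
    unfolding z_def using measurable_compose[OF measurable_Pair1'[OF that(2)] meas[OF that(1)]] bnd that
    by (intro \<rho>.abs_expectation_le) auto
  define S where "S j x = (\<Sum>i<N. f j x (w i) - z j x)" for j x
  have "\<exists>v\<in>space \<rho>. (\<integral>x. (\<Sum>j\<in>J. (S j x + (f j x v - (\<integral>v. f j x v \<partial>\<rho>)))\<^sup>2) \<partial>\<mu>)
      \<le> (\<integral>x. (\<Sum>j\<in>J. (S j x)\<^sup>2) \<partial>\<mu>) + D"
  \<comment> \<open>Each of the \<open>N\<close> summands is a value minus a mean, both at most
    \<open>c\<close> in absolute value.\<close>
  proof (rule greedy_step[where c=c and c'="real N * (c + c)"])
    fix j assume j: "j \<in> J"
    have "(\<lambda>x. f j x (w i)) \<in> borel_measurable \<mu>" if "i < N" for i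
      using measurable_compose[OF measurable_Pair2'[OF w[OF that]] meas[OF j]] by simp
    moreover have "z j \<in> borel_measurable \<mu>"
      unfolding z_def using meas[OF j] by (rule \<rho>.borel_measurable_lebesgue_integral)
    ultimately show "S j \<in> borel_measurable \<mu>"
      unfolding S_def by (intro borel_measurable_sum borel_measurable_diff) auto
    fix x assume x: "x \<in> space \<mu>"
    have "\<bar>S j x\<bar> \<le> (\<Sum>i<N. \<bar>f j x (w i) - z j x\<bar>)"
      unfolding S_def by (rule sum_abs)
    also have "\<dots> \<le> (\<Sum>i<N. c + c)"
      using bnd[OF j x w] z_bnd[OF j x] by (intro sum_mono) fastforce
    finally show "\<bar>S j x\<bar> \<le> real N * (c + c)" by simp
  qed (use assms in auto)
  then obtain v where v: "v \<in> space \<rho>"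
    "(\<integral>x. (\<Sum>j\<in>J. (S j x + (f j x v - z j x))\<^sup>2) \<partial>\<mu>) \<le> (\<integral>x. (\<Sum>j\<in>J. (S j x)\<^sup>2) \<partial>\<mu>) + D"
    by (auto simp: z_def)
  \<comment> \<open>The new point goes into slot \<open>N\<close>, which leaves the slots below
    \<open>N\<close>, and with them \<open>S\<close>, unchanged.\<close>
  have eq: "(\<Sum>i<Suc N. f j x ((w(N := v)) i) - z j x) = S j x + (f j x v - z j x)" for j x
    by (simp add: S_def)
  have "(\<integral>x. (\<Sum>j\<in>J. (\<Sum>i<Suc N. f j x ((w(N := v)) i) - z j x)\<^sup>2) \<partial>\<mu>) \<le> real (Suc N) * D"
    unfolding eq using v(2) le by (simp add: S_def algebra_simps)
  then show ?case
    unfolding z_def using w v(1) by (intro exI[of _ "w(N := v)"]) (auto simp: less_Suc_eq)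
qed

section \<open>Cross-entropy with a one-hot label\<close>

text \<open>The label selects one logit, and log-sum-exp dominates every single logit.\<close>

lemma cross_entropy_unit_vec_nonneg:
  assumes "dim_vec z = dv" "j < dv"
  shows "0 \<le> cross_entropy dv (unit_vec dv j) z"
proof -
  have "z \<in> carrier_vec dv" using assms by auto
  then have "scalar_prod (unit_vec dv j) z = z $ j" using assms by simp
  moreover have "exp (z $ j) \<le> (\<Sum>j<dv. exp (z $ j))"
    using assms by (intro member_le_sum) auto
  then have "z $ j \<le> ln (\<Sum>j<dv. exp (z $ j))"
    by (metis exp_gt_zero ln_exp ln_le_cancel_iff order_less_le_trans)
  ultimately show ?thesis by (simp add: cross_entropy_def)
qed

text \<open>Log-sum-exp rises by at most \<delta>, because each exponential grows by a factor of at
  most \<open>exp \<delta>\<close>; the logit selected by the label accounts for the other \<delta>.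
  The sup norm keeps the constant 2 independent of \<open>dv\<close>.\<close>

lemma cross_entropy_unit_vec_le:
  assumes "dim_vec z = dv" "dim_vec z' = dv" "j < dv"
    and near: "\<And>i. i < dv \<Longrightarrow> \<bar>z $ i - z' $ i\<bar> \<le> \<delta>"
  shows "cross_entropy dv (unit_vec dv j) z \<le> cross_entropy dv (unit_vec dv j) z' + 2 * \<delta>"
proof -
  have "z \<in> carrier_vec dv" "z' \<in> carrier_vec dv" using assms by (auto intro: carrier_vecI)
  then have y: "scalar_prod (unit_vec dv j) z = z $ j" "scalar_prod (unit_vec dv j) z' = z' $ j"
    using assms by simp_all
  have pos: "0 < (\<Sum>i<dv. exp (u i))" for u :: "nat \<Rightarrow> real"
    using assms by (intro sum_pos) auto
  have "(\<Sum>i<dv. exp (z $ i)) \<le> (\<Sum>i<dv. exp \<delta> * exp (z' $ i))"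
  proof (rule sum_mono)
    fix i assume "i \<in> {..<dv}"
    then have "z $ i \<le> \<delta> + z' $ i" using near[of i] by auto
    then show "exp (z $ i) \<le> exp \<delta> * exp (z' $ i)" by (simp flip: exp_add)
  qed
  then have "(\<Sum>i<dv. exp (z $ i)) \<le> exp \<delta> * (\<Sum>i<dv. exp (z' $ i))"
    by (simp add: sum_distrib_left)
  then have "ln (\<Sum>i<dv. exp (z $ i)) \<le> ln (exp \<delta> * (\<Sum>i<dv. exp (z' $ i)))"
    using pos by (subst ln_le_cancel_iff) auto
  also have "\<dots> = \<delta> + ln (\<Sum>i<dv. exp (z' $ i))"
    using pos by (subst ln_mult_pos) auto
  finally show ?thesis
    using near[OF assms(3)] by (simp add: cross_entropy_def y)
qed

section \<open>Joint measurability of the head output\<close>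

text \<open>Measurability is entrywise, so no sigma-algebra on matrices is involved. The dimensions
  are fixed for every argument, even outside the space of \<open>M\<close>, so that the index rules
  rewrite under the lambda.\<close>

definition measurable_mat :: "'a measure \<Rightarrow> nat \<Rightarrow> nat \<Rightarrow> ('a \<Rightarrow> real mat) \<Rightarrow> bool" where
  "measurable_mat M m n A \<longleftrightarrow> (\<forall>x. A x \<in> carrier_mat m n) \<and>
     (\<forall>i<m. \<forall>j<n. (\<lambda>x. A x $$ (i, j)) \<in> borel_measurable M)"

lemma measurable_mat_mult:
  assumes "measurable_mat M m n A" "measurable_mat M n p B"
  shows "measurable_mat M m p (\<lambda>x. A x * B x)"
  unfolding measurable_mat_def
proof (intro conjI allI impI)
  have A: "A x \<in> carrier_mat m n" and B: "B x \<in> carrier_mat n p" for x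
    using assms by (auto simp: measurable_mat_def)
  show "A x * B x \<in> carrier_mat m p" for x
    using A B by (rule mult_carrier_mat)
  fix i j assume ij: "i < m" "j < p"
  have "(A x * B x) $$ (i, j) = (\<Sum>k<n. A x $$ (i, k) * B x $$ (k, j))" for x
    using A[of x] B[of x] ij by (auto simp: scalar_prod_def atLeast0LessThan)
  then show "(\<lambda>x. (A x * B x) $$ (i, j)) \<in> borel_measurable M"
    using assms ij by (auto simp: measurable_mat_def intro!: borel_measurable_sum borel_measurable_times)
qed

lemma measurable_mat_transpose:
  assumes "measurable_mat M m n A"
  shows "measurable_mat M n m (\<lambda>x. transpose_mat (A x))"
proof -
  have A: "A x \<in> carrier_mat m n" for x
    using assms by (auto simp: measurable_mat_def)
  have "transpose_mat (A x) $$ (i, j) = A x $$ (j, i)" if "i < n" "j < m" for x i j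
    using A[of x] that by (intro index_transpose_mat) auto
  then show ?thesis
    using assms by (auto simp: measurable_mat_def)
qed

lemma measurable_mat_mat:
  assumes "\<And>i j. i < m \<Longrightarrow> j < n \<Longrightarrow> (\<lambda>x. f x (i, j)) \<in> borel_measurable M"
  shows "measurable_mat M m n (\<lambda>x. mat m n (f x))"
  using assms by (auto simp: measurable_mat_def)

lemma borel_measurable_coordinate: "(\<lambda>w::nat \<Rightarrow> real. w i) \<in> borel_measurable borel"
  by (intro borel_measurable_continuous_onI continuous_on_product_coordinates)

text \<open>Fubini and the measurability of mean outputs both rest on joint measurability in input
  and head. The output is an iterated matrix product, and entries of a product are finite sums of
  products of entries.\<close>

lemma head_output_measurable:
  assumes Wout: "Wout \<in> carrier_mat dx dv" and l: "l < L" and j: "j < dv"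
  shows "(\<lambda>(X, w). head_output L dx dk Wout l X w $ j) \<in> borel_measurable
    (Pi\<^sub>M {..<L} (\<lambda>_. restrict_space borel Kx) \<Otimes>\<^sub>M restrict_space borel K)"
    (is "_ \<in> borel_measurable ?M")
proof -
  have w: "(\<lambda>p. snd p i) \<in> borel_measurable ?M" for i
    by (rule measurable_compose[OF measurable_snd])
      (rule measurable_restrict_space1[OF borel_measurable_coordinate])
  have x: "(\<lambda>p. fst p l i) \<in> borel_measurable ?M" if "l < L" for l i
  proof -
    have "(\<lambda>p. fst p l) \<in> ?M \<rightarrow>\<^sub>M restrict_space borel Kx"
      using that by (intro measurable_compose[OF measurable_fst] measurable_component_singleton) auto
    from measurable_compose[OF this measurable_restrict_space1[OF borel_measurable_coordinate]]
    show ?thesis .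
  qed
  have X: "measurable_mat ?M L dx (\<lambda>p. input_mat L dx (fst p))"
    unfolding input_mat_def using x by (intro measurable_mat_mat) auto
  have Q: "measurable_mat ?M dx dk (\<lambda>p. W_Q dx dk (snd p))"
    unfolding W_Q_def using w by (intro measurable_mat_mat) auto
  have Ke: "measurable_mat ?M dx dk (\<lambda>p. W_K dx dk (snd p))"
    unfolding W_K_def using w by (intro measurable_mat_mat) auto
  have V: "measurable_mat ?M dx dk (\<lambda>p. W_V dx dk (snd p))"
    unfolding W_V_def using w by (intro measurable_mat_mat) auto
  have Ou: "measurable_mat ?M dk dx (\<lambda>p. W_O dx dk (snd p))"
    unfolding W_O_def using w by (intro measurable_mat_mat) auto
  have Wo: "measurable_mat ?M dx dv (\<lambda>p. Wout)"
    using Wout by (auto simp: measurable_mat_def)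
  have "measurable_mat ?M L L (\<lambda>p. score_mat L dx dk (fst p) (snd p))"
    unfolding score_mat_def
    by (rule measurable_mat_mult measurable_mat_transpose X Q Ke)+
  then have s: "(\<lambda>p. score_mat L dx dk (fst p) (snd p) $$ (r, s)) \<in> borel_measurable ?M"
    if "r < L" "s < L" for r s
    using that by (auto simp: measurable_mat_def)
  have A: "measurable_mat ?M L L (\<lambda>p. attention_mat L dx dk (fst p) (snd p))"
    unfolding attention_mat_def
  proof (rule measurable_mat_mat)
    fix r t assume rt: "r < L" "t < L"
    have [measurable]: "(\<lambda>p. score_mat L dx dk (fst p) (snd p) $$ (r, t)) \<in> borel_measurable ?M"
      using s rt by auto
    \<comment> \<open>Every \<open>s'\<close> in the normalising sum is at most \<open>r\<close>,
      hence below \<open>L\<close>, so all score entries are in range.\<close>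
    have [measurable]: "(\<lambda>p. \<Sum>s'\<le>r. exp (score_mat L dx dk (fst p) (snd p) $$ (r, s') / sqrt (real dk)))
        \<in> borel_measurable ?M"
      using s rt
      by (intro borel_measurable_sum measurable_compose[OF _ borel_measurable_exp] borel_measurable_divide) auto
    \<comment> \<open>The causal mask depends on \<open>r\<close> and \<open>t\<close> alone, so at
      a fixed entry the same branch applies for all \<open>p\<close>.\<close>
    show "(\<lambda>p. case (r, t) of (r, s) \<Rightarrow> if s \<le> r
        then exp (score_mat L dx dk (fst p) (snd p) $$ (r, s) / sqrt (real dk)) /
          (\<Sum>s'\<le>r. exp (score_mat L dx dk (fst p) (snd p) $$ (r, s') / sqrt (real dk)))
        else 0) \<in> borel_measurable ?M"
      by (cases "t \<le> r") (simp_all, measurable)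
  qed
  have O: "measurable_mat ?M L dv (\<lambda>p. attention_mat L dx dk (fst p) (snd p) * input_mat L dx (fst p)
      * W_V dx dk (snd p) * W_O dx dk (snd p) * Wout)" (is "measurable_mat _ _ _ ?O")
    by (rule measurable_mat_mult A X V Ou Wo)+
  then have "?O p \<in> carrier_mat L dv" for p
    unfolding measurable_mat_def by blast
  then have "l < dim_row (?O p)" "j < dim_col (?O p)" for p
    using l j by (metis carrier_matD(1), metis carrier_matD(2))
  then have "head_output L dx dk Wout l (fst p) (snd p) $ j = ?O p $$ (l, j)" for p
    unfolding head_output_def by (rule index_row(1))
  then show ?thesis
    using O l j by (auto simp: measurable_mat_def case_prod_unfold)
qed

section \<open>Empirical measures\<close>

lemma measurable_uniform_count_restrict:
  assumes "w \<in> {..<N} \<rightarrow> K"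
  shows "w \<in> uniform_count_measure {..<N} \<rightarrow>\<^sub>M restrict_space borel K"
  using assms by (auto simp: measurable_def space_uniform_count_measure sets_uniform_count_measure space_restrict_space)

text \<open>Drawing an index uniformly and reading off its head gives each head its multiplicity
  divided by \<open>N\<close>. As a pushforward, the empirical measure inherits total mass 1 and the
  change of variables formula.\<close>

lemma empirical_measure_eq_distr:
  assumes w: "w \<in> {..<N} \<rightarrow> K" and N: "N \<ge> 1"
  shows "empirical_measure K N w = distr (uniform_count_measure {..<N}) (restrict_space borel K) w"
    (is "_ = distr ?U ?R w")
proof (rule measure_eqI)
  have [measurable]: "w \<in> ?U \<rightarrow>\<^sub>M ?R"
    by (rule measurable_uniform_count_restrict[OF w])
  show sets: "sets (empirical_measure K N w) = sets (distr ?U ?R w)"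
    unfolding empirical_measure_def
    using sets.sets_measure_of_eq[of ?R] by (simp add: space_restrict_space)
  fix A assume "A \<in> sets (empirical_measure K N w)"
  then have A [measurable]: "A \<in> sets ?R" by (simp add: sets)
  have "emeasure (empirical_measure K N w) A = (\<Sum>i<N. indicator A (w i)) / of_nat N"
    using A by (simp add: emeasure_empirical_measure)
  \<comment> \<open>Indices are counted, not heads, so repeated heads keep their weight.\<close>
  also have "(\<Sum>i<N. indicator A (w i) :: ennreal) = of_nat (card (w -` A \<inter> {..<N}))"
    by (simp add: indicator_def sum.If_cases vimage_def Int_def conj_commute)
  also have "of_nat (card (w -` A \<inter> {..<N})) / of_nat N = emeasure ?U (w -` A \<inter> {..<N})"
    using N by (subst emeasure_uniform_count_measure)
      (auto simp: divide_ennreal ennreal_of_nat_eq_real_of_nat)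
  also have "\<dots> = emeasure (distr ?U ?R w) A"
    by (simp add: emeasure_distr space_uniform_count_measure)
  finally show "emeasure (empirical_measure K N w) A = emeasure (distr ?U ?R w) A" .
qed

lemma empirical_measure_in_prob_measures_on:
  assumes w: "w \<in> {..<N} \<rightarrow> K" and N: "N \<ge> 1"
  shows "empirical_measure K N w \<in> prob_measures_on K"
proof -
  interpret U: prob_space "uniform_count_measure {..<N}"
    using N by (intro prob_space_uniform_count_measure) (auto simp: lessThan_empty_iff)
  show ?thesis
    unfolding prob_measures_on_def empirical_measure_eq_distr[OF assms]
    using U.prob_space_distr[OF measurable_uniform_count_restrict[OF w]] by simp
qed

lemma integral_empirical_measure:
  fixes f :: "(nat \<Rightarrow> real) \<Rightarrow> real"
  assumes w: "w \<in> {..<N} \<rightarrow> K" and N: "N \<ge> 1"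
    and f: "f \<in> borel_measurable (restrict_space borel K)"
  shows "(\<integral>v. f v \<partial>empirical_measure K N w) = (\<Sum>i<N. f (w i)) / real N"
  unfolding empirical_measure_eq_distr[OF w N]
  by (simp add: integral_distr[OF measurable_uniform_count_restrict[OF w] f] integral_uniform_count_measure)

section \<open>Sign and order zero of the derivative norm\<close>

text \<open>The supremum is over a nonempty set, since \<open>k\<close> copies of the zero direction
  are admissible, and each value is a Euclidean norm.\<close>

lemma deriv_norm_nonneg: "0 \<le> deriv_norm k n m F w"
proof -
  let ?hs = "replicate k (\<lambda>_::nat. 0::real)"
  have "ereal (L2_set (\<lambda>j. foldr dir_deriv ?hs (\<lambda>v. F v $ j) w) {..<m}) \<le> deriv_norm k n m F w"
    unfolding deriv_norm_def
    by (rule SUP_upper) (auto simp: topspace_Euclidean_space L2_set_def)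
  then show ?thesis
    by (rule order_trans[rotated]) (simp add: L2_set_nonneg)
qed

lemma deriv_norm_0: "deriv_norm 0 n m F w = ereal (L2_set (\<lambda>j. F w $ j) {..<m})"
proof -
  have "{hs. length hs = 0 \<and> (\<forall>h\<in>set hs. h \<in> topspace (Euclidean_space n) \<and> L2_set h {..<n} \<le> 1)} = {[]}"
    by auto
  then show ?thesis by (simp add: deriv_norm_def)
qed

section \<open>Mean outputs and losses under a uniform output bound\<close>

text \<open>\<open>b\<close> bounds the Euclidean norm of every head output. It is strictly positive
  because \<open>b / sqrt (real N)\<close> will occur as a divisor.\<close>

locale attention_setting =
  fixes L dx dk dv :: nat and Wout :: "real mat" and K Kx :: "(nat \<Rightarrow> real) set"
    and \<mu> :: "(nat \<Rightarrow> nat \<Rightarrow> real) measure" and Y :: "nat \<Rightarrow> (nat \<Rightarrow> nat \<Rightarrow> real) \<Rightarrow> real vec"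
    and b :: real
  assumes L: "L \<ge> 1" and Wout: "Wout \<in> carrier_mat dx dv"
    and data: "data_model L dv Kx \<mu> Y" and b: "0 < b"
    and head_bound: "\<And>X l w. X \<in> PiE {..<L} (\<lambda>_. Kx) \<Longrightarrow> l < L \<Longrightarrow> w \<in> K \<Longrightarrow>
      (\<Sum>j<dv. (head_output L dx dk Wout l X w $ j)\<^sup>2) \<le> b\<^sup>2"
begin

abbreviation "\<psi> \<equiv> head_output L dx dk Wout"
abbreviation "Z \<equiv> mean_output L dx dk dv Wout"
abbreviation "R \<equiv> risk L dx dk dv Wout \<mu> Y"

sublocale \<mu>: prob_space \<mu>
  using data by (auto simp: data_model_def)

lemma space_\<mu>: "space \<mu> = PiE {..<L} (\<lambda>_. Kx)"
  using data sets_eq_imp_space_eq[of \<mu> "Pi\<^sub>M {..<L} (\<lambda>_. restrict_space borel Kx)"]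
  by (simp add: data_model_def space_PiM space_restrict_space)

lemma label: "l < L \<Longrightarrow> X \<in> space \<mu> \<Longrightarrow> \<exists>j<dv. Y l X = unit_vec dv j"
  and label_measurable: "l < L \<Longrightarrow> j < dv \<Longrightarrow> (\<lambda>X. Y l X $ j) \<in> borel_measurable \<mu>"
  using data by (auto simp: data_model_def)

lemma head_entry_bound:
  assumes "X \<in> space \<mu>" "l < L" "j < dv" "w \<in> K"
  shows "\<bar>\<psi> l X w $ j\<bar> \<le> b"
proof -
  have "(\<psi> l X w $ j)\<^sup>2 \<le> (\<Sum>j<dv. (\<psi> l X w $ j)\<^sup>2)"
    using assms by (intro member_le_sum) auto
  also have "\<dots> \<le> b\<^sup>2"
    using assms by (intro head_bound) (auto simp: space_\<mu>)
  finally show ?thesis using b by (simp flip: abs_le_square_iff)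
qed

lemma prob_measures_onD:
  assumes "\<rho> \<in> prob_measures_on K"
  shows "prob_space \<rho>" "sets \<rho> = sets (restrict_space borel K)" "space \<rho> = K"
  using assms sets_eq_imp_space_eq[of \<rho> "restrict_space borel K"]
  by (auto simp: prob_measures_on_def space_restrict_space)

lemma head_measurable_pair:
  assumes "\<rho> \<in> prob_measures_on K" "l < L" "j < dv"
  shows "(\<lambda>(X, w). \<psi> l X w $ j) \<in> borel_measurable (\<mu> \<Otimes>\<^sub>M \<rho>)"
proof -
  have "sets (\<mu> \<Otimes>\<^sub>M \<rho>) = sets (Pi\<^sub>M {..<L} (\<lambda>_. restrict_space borel Kx) \<Otimes>\<^sub>M restrict_space borel K)"
    using data prob_measures_onD[OF assms(1)]
    by (intro sets_pair_measure_cong) (auto simp: data_model_def)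
  from measurable_cong_sets[OF this refl] show ?thesis
    using head_output_measurable[OF Wout assms(2,3)] by blast
qed

lemma head_measurable:
  assumes "X \<in> space \<mu>" "l < L" "j < dv"
  shows "(\<lambda>w. \<psi> l X w $ j) \<in> borel_measurable (restrict_space borel K)"
proof -
  have "X \<in> space (Pi\<^sub>M {..<L} (\<lambda>_. restrict_space borel Kx))"
    using assms(1) by (simp add: space_\<mu> space_PiM space_restrict_space)
  from measurable_compose[OF measurable_Pair1'[OF this] head_output_measurable[OF Wout assms(2,3)]]
  show ?thesis by simp
qed

lemma mean_output_index: "j < dv \<Longrightarrow> Z \<rho> l X $ j = (\<integral>w. \<psi> l X w $ j \<partial>\<rho>)"
  by (simp add: mean_output_def)

lemma dim_mean_output: "dim_vec (Z \<rho> l X) = dv"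
  by (simp add: mean_output_def)

lemma mean_output_measurable:
  assumes "\<rho> \<in> prob_measures_on K" "l < L" "j < dv"
  shows "(\<lambda>X. Z \<rho> l X $ j) \<in> borel_measurable \<mu>"
proof -
  interpret \<rho>: prob_space \<rho> using prob_measures_onD[OF assms(1)] by simp
  show ?thesis
    unfolding mean_output_index[OF assms(3)]
    using head_measurable_pair[OF assms] by (rule \<rho>.borel_measurable_lebesgue_integral)
qed

lemma mean_output_bound:
  assumes "\<rho> \<in> prob_measures_on K" "X \<in> space \<mu>" "l < L" "j < dv"
  shows "\<bar>Z \<rho> l X $ j\<bar> \<le> b"
proof -
  note \<rho> = prob_measures_onD[OF assms(1)]
  have "(\<lambda>w. \<psi> l X w $ j) \<in> borel_measurable \<rho>"
    using head_measurable[OF assms(2-4)] measurable_cong_sets[OF \<rho>(2) refl] by blast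
  then show ?thesis
    unfolding mean_output_index[OF assms(4)]
    using head_entry_bound assms \<rho> by (intro prob_space.abs_expectation_le) auto
qed

lemma loss_nonneg:
  assumes "X \<in> space \<mu>" "l < L"
  shows "0 \<le> cross_entropy dv (Y l X) (Z \<rho> l X)"
  using label[OF assms(2,1)] by (auto intro!: cross_entropy_unit_vec_nonneg simp: dim_mean_output)

text \<open>The loss is nonnegative at every input, whatever \<rho> is, and a Bochner integral that
  does not exist has value 0. This bounds both infima from below.\<close>

lemma risk_nonneg: "0 \<le> R \<rho>"
  unfolding risk_def
  by (intro Bochner_Integration.integral_nonneg_AE AE_I2 mult_nonneg_nonneg sum_nonneg loss_nonneg) auto

lemma integrable_loss:
  assumes "\<rho> \<in> prob_measures_on K" "l < L"
  shows "integrable \<mu> (\<lambda>X. cross_entropy dv (Y l X) (Z \<rho> l X))"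
proof (rule \<mu>.integrable_const_bound[where B="ln (real dv) + 2 * b"])
  show "AE X in \<mu>. norm (cross_entropy dv (Y l X) (Z \<rho> l X)) \<le> ln (real dv) + 2 * b"
  proof (rule AE_I2)
    fix X assume X: "X \<in> space \<mu>"
    obtain j where j: "j < dv" "Y l X = unit_vec dv j"
      using label[OF assms(2) X] by auto
    \<comment> \<open>The comparison point is the zero logit vector, whose loss is
      \<open>ln (real dv)\<close>.\<close>
    have "cross_entropy dv (unit_vec dv j) (Z \<rho> l X) \<le> cross_entropy dv (unit_vec dv j) (0\<^sub>v dv) + 2 * b"
      using mean_output_bound[OF assms(1) X assms(2)] j
      by (intro cross_entropy_unit_vec_le) (auto simp: dim_mean_output)
    then show "norm (cross_entropy dv (Y l X) (Z \<rho> l X)) \<le> ln (real dv) + 2 * b"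
      using loss_nonneg[OF X assms(2), of \<rho>] j by (simp add: cross_entropy_def)
  qed
  show "(\<lambda>X. cross_entropy dv (Y l X) (Z \<rho> l X)) \<in> borel_measurable \<mu>"
    unfolding cross_entropy_def scalar_prod_def dim_mean_output
    using label_measurable[OF assms(2)] mean_output_measurable[OF assms]
    by (intro borel_measurable_diff borel_measurable_ln borel_measurable_sum borel_measurable_times
        measurable_compose[OF _ borel_measurable_exp]) auto
qed

section \<open>Approximating a measure by \<open>N\<close> heads\<close>

text \<open>Greedy sampling applies to all output coordinates at all positions at once. Dividing its
  bound by the square of \<open>N\<close> puts the two mean outputs at mean squared distance at most
  \<open>L * b\<^sup>2 / N\<close>, and the Lipschitz bound on the loss converts this into
  risk.\<close>

lemma exists_heads_near_risk:
  assumes \<rho>: "\<rho> \<in> prob_measures_on K" and N: "N \<ge> 1"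
  shows "\<exists>w\<in>{..<N} \<rightarrow> K. N_head_risk L dx dk dv Wout \<mu> Y K N w \<le> R \<rho> + 2 * b / sqrt (real N)"
proof -
  note \<rho>D = prob_measures_onD[OF \<rho>]
  \<comment> \<open>An index is a position together with a coordinate, so the sum over
    \<open>J\<close> is the squared norm of the whole output matrix.\<close>
  define J where "J = {..<L} \<times> {..<dv}"
  define f where "f = (\<lambda>(l, j) X w. \<psi> l X w $ j)"
  have f_sq: "(\<Sum>p\<in>J. (f p X w)\<^sup>2) \<le> real L * b\<^sup>2" if "X \<in> space \<mu>" "w \<in> K" for X w
  proof -
    have "(\<Sum>p\<in>J. (f p X w)\<^sup>2) = (\<Sum>l<L. \<Sum>j<dv. (\<psi> l X w $ j)\<^sup>2)"
      by (simp add: J_def f_def sum.cartesian_product case_prod_unfold)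
    also have "\<dots> \<le> (\<Sum>l<L. b\<^sup>2)"
      using that by (intro sum_mono head_bound) (auto simp: space_\<mu>)
    finally show ?thesis by simp
  qed
  define S where "S w p X = (\<Sum>i<N. f p X (w i) - (\<integral>v. f p X v \<partial>\<rho>))" for w p X
  have "\<exists>w. (\<forall>i<N. w i \<in> space \<rho>) \<and> (\<integral>X. (\<Sum>p\<in>J. (S w p X)\<^sup>2) \<partial>\<mu>) \<le> real N * (real L * b\<^sup>2)"
    unfolding S_def
  proof (rule greedy_sampling[where c=b])
    show "(\<lambda>(X, w). f p X w) \<in> borel_measurable (\<mu> \<Otimes>\<^sub>M \<rho>)" if "p \<in> J" for p
      using head_measurable_pair[OF \<rho>] that by (auto simp: J_def f_def)
  qed (use f_sq head_entry_bound \<rho>D \<mu>.prob_space_axioms in \<open>auto simp: J_def f_def\<close>)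
  then obtain w where w: "w \<in> {..<N} \<rightarrow> K"
    and S_le: "(\<integral>X. (\<Sum>p\<in>J. (S w p X)\<^sup>2) \<partial>\<mu>) \<le> real N * (real L * b\<^sup>2)"
    using \<rho>D by auto
  define \<eta> where "\<eta> = empirical_measure K N w"
  have \<eta>: "\<eta> \<in> prob_measures_on K"
    unfolding \<eta>_def by (rule empirical_measure_in_prob_measures_on[OF w N])
  \<comment> \<open>The accumulated deviation is \<open>N\<close> times the difference of the two
    mean outputs, since \<eta> averages over the chosen heads.\<close>
  have S_eq: "S w (l, j) X = real N * (Z \<eta> l X $ j - Z \<rho> l X $ j)"
    if "X \<in> space \<mu>" "l < L" "j < dv" for l j X
    using integral_empirical_measure[OF w N head_measurable[OF that]] N that
    by (simp add: S_def f_def mean_output_index \<eta>_def sum_subtractf right_diff_distrib)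
  have S_int: "integrable \<mu> (\<lambda>X. \<Sum>p\<in>J. (S w p X)\<^sup>2)"
  proof (intro Bochner_Integration.integrable_sum)
    fix p assume "p \<in> J"
    then obtain l j where p: "p = (l, j)" "l < L" "j < dv" by (auto simp: J_def)
    have "integrable \<mu> (\<lambda>X. (real N * (Z \<eta> l X $ j - Z \<rho> l X $ j))\<^sup>2)"
    proof (rule \<mu>.integrable_const_bound[where B="(real N * (b + b))\<^sup>2"])
      note [measurable] = mean_output_measurable[OF \<eta> p(2,3)] mean_output_measurable[OF \<rho> p(2,3)]
      show "(\<lambda>X. (real N * (Z \<eta> l X $ j - Z \<rho> l X $ j))\<^sup>2) \<in> borel_measurable \<mu>"
        by measurable
      show "AE X in \<mu>. norm ((real N * (Z \<eta> l X $ j - Z \<rho> l X $ j))\<^sup>2) \<le> (real N * (b + b))\<^sup>2"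
      proof (rule AE_I2)
        fix X assume X: "X \<in> space \<mu>"
        have "\<bar>Z \<eta> l X $ j - Z \<rho> l X $ j\<bar> \<le> \<bar>b + b\<bar>"
          using mean_output_bound[OF \<eta> X p(2,3)] mean_output_bound[OF \<rho> X p(2,3)] by linarith
        then show "norm ((real N * (Z \<eta> l X $ j - Z \<rho> l X $ j))\<^sup>2) \<le> (real N * (b + b))\<^sup>2"
          by (simp add: power_mult_distrib abs_le_square_iff mult_left_mono)
      qed
    qed
    moreover have "integrable \<mu> (\<lambda>X. (S w p X)\<^sup>2) \<longleftrightarrow>
        integrable \<mu> (\<lambda>X. (real N * (Z \<eta> l X $ j - Z \<rho> l X $ j))\<^sup>2)"
      using p S_eq by (intro Bochner_Integration.integrable_cong) auto
    ultimately show "integrable \<mu> (\<lambda>X. (S w p X)\<^sup>2)"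
      by simp
  qed
  define a where "a = b / sqrt (real N)"
  have a: "0 < a" using b N by (simp add: a_def)
  \<comment> \<open>The loss is summed over positions; the factor \<open>1 / real L\<close> returns
    in \<open>R_eq\<close>.\<close>
  define loss where "loss \<sigma> X = (\<Sum>l<L. cross_entropy dv (Y l X) (Z \<sigma> l X))" for \<sigma> X
  have loss_int: "integrable \<mu> (loss \<sigma>)" if "\<sigma> \<in> prob_measures_on K" for \<sigma>
    unfolding loss_def[abs_def] using integrable_loss[OF that] by auto
  have pointwise: "loss \<eta> X \<le> loss \<rho> X + ((\<Sum>p\<in>J. (S w p X)\<^sup>2) / ((real N)\<^sup>2 * a) + real L * a)"
    if X: "X \<in> space \<mu>" for X
  proof -
    \<comment> \<open>The squared Euclidean distance at position \<open>l\<close> dominates the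
      square of each coordinate difference, which links the sup norm of the Lipschitz bound to the
      \<open>L\<^sup>2\<close> bound.\<close>
    define q where "q l = (\<Sum>j<dv. (Z \<eta> l X $ j - Z \<rho> l X $ j)\<^sup>2)" for l
    have "loss \<eta> X \<le> (\<Sum>l<L. cross_entropy dv (Y l X) (Z \<rho> l X) + 2 * ((q l / a + a) / 2))"
      unfolding loss_def
    proof (rule sum_mono)
      fix l assume "l \<in> {..<L}"
      then have l: "l < L" by simp
      obtain j where j: "j < dv" "Y l X = unit_vec dv j"
        using label[OF l X] by auto
      show "cross_entropy dv (Y l X) (Z \<eta> l X)
          \<le> cross_entropy dv (Y l X) (Z \<rho> l X) + 2 * ((q l / a + a) / 2)"
        unfolding j(2)
      proof (rule cross_entropy_unit_vec_le[OF dim_mean_output dim_mean_output j(1)])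
        fix i assume i: "i < dv"
        let ?d = "Z \<eta> l X $ i - Z \<rho> l X $ i"
        \<comment> \<open>AM-GM with the final rate \<open>a\<close> as weight replaces Jensen's inequality for the square root.\<close>
        have "0 \<le> (\<bar>?d\<bar> - a)\<^sup>2" by simp
        then have "2 * \<bar>?d\<bar> * a \<le> ?d\<^sup>2 + a\<^sup>2"
          by (simp add: power2_diff)
        also have "?d\<^sup>2 \<le> q l"
          unfolding q_def using i by (intro member_le_sum) auto
        finally show "\<bar>?d\<bar> \<le> (q l / a + a) / 2"
          using a by (simp add: field_simps power2_eq_square)
      qed
    qed
    also have "\<dots> = loss \<rho> X + ((\<Sum>l<L. q l) / a + real L * a)"
      by (simp add: loss_def sum.distrib sum_divide_distrib add_divide_distrib)
    also have "(\<Sum>l<L. q l) = (\<Sum>p\<in>J. (S w p X)\<^sup>2) / (real N)\<^sup>2"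
    proof -
      have "(\<Sum>p\<in>J. (S w p X)\<^sup>2) = (\<Sum>l<L. \<Sum>j<dv. (S w (l, j) X)\<^sup>2)"
        by (simp add: J_def sum.cartesian_product)
      also have "\<dots> = (\<Sum>l<L. (real N)\<^sup>2 * q l)"
        unfolding q_def sum_distrib_left using X
        by (intro sum.cong refl) (simp add: S_eq power_mult_distrib)
      finally show ?thesis
        using N by (simp flip: sum_distrib_left)
    qed
    finally show ?thesis by (simp add: mult.commute)
  qed
  have R_eq: "R \<sigma> = (\<integral>X. loss \<sigma> X \<partial>\<mu>) / real L" for \<sigma>
    by (simp add: risk_def loss_def)
  have "(\<integral>X. loss \<eta> X \<partial>\<mu>)
      \<le> (\<integral>X. loss \<rho> X + ((\<Sum>p\<in>J. (S w p X)\<^sup>2) / ((real N)\<^sup>2 * a) + real L * a) \<partial>\<mu>)"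
    using pointwise loss_int[OF \<rho>] loss_int[OF \<eta>] S_int
    by (intro integral_mono Bochner_Integration.integrable_add integrable_divide) auto
  also have "\<dots> = (\<integral>X. loss \<rho> X \<partial>\<mu>) + ((\<integral>X. (\<Sum>p\<in>J. (S w p X)\<^sup>2) \<partial>\<mu>) / ((real N)\<^sup>2 * a) + real L * a)"
    using loss_int[OF \<rho>] S_int by (simp add: \<mu>.prob_space)
  also have "(\<integral>X. (\<Sum>p\<in>J. (S w p X)\<^sup>2) \<partial>\<mu>) / ((real N)\<^sup>2 * a)
      \<le> real N * (real L * b\<^sup>2) / ((real N)\<^sup>2 * a)"
    using S_le a by (intro divide_right_mono) auto
  \<comment> \<open>For this \<open>a\<close> the quadratic part is bounded by the same
    \<open>real L * a\<close> as the linear part, hence the total \<open>2 * a\<close> per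
    position.\<close>
  also have "real N * (real L * b\<^sup>2) / ((real N)\<^sup>2 * a) = real L * a"
    using N b by (simp add: a_def power2_eq_square field_simps)
  finally have "(\<integral>X. loss \<eta> X \<partial>\<mu>) \<le> (\<integral>X. loss \<rho> X \<partial>\<mu>) + real L * (2 * a)"
    by (simp add: ac_simps)
  then have "R \<eta> \<le> R \<rho> + 2 * a"
    using L by (simp add: R_eq field_simps)
  then show ?thesis
    using w by (auto simp: N_head_risk_def \<eta>_def a_def)
qed

section \<open>Comparing the two infima\<close>

lemma risk_gap:
  assumes N: "N \<ge> 1" and K: "K \<noteq> {}"
  shows "0 \<le> (INF w \<in> {..<N} \<rightarrow> K. N_head_risk L dx dk dv Wout \<mu> Y K N w) - (INF \<rho> \<in> prob_measures_on K. R \<rho>)"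
    and "(INF w \<in> {..<N} \<rightarrow> K. N_head_risk L dx dk dv Wout \<mu> Y K N w) - (INF \<rho> \<in> prob_measures_on K. R \<rho>)
      \<le> 2 * b / sqrt (real N)"
proof -
  let ?E = "N_head_risk L dx dk dv Wout \<mu> Y K N"
  \<comment> \<open>Infima of real sets obey the usual rules for nonempty sets bounded below, so
    these facts come first.\<close>
  have ne: "{..<N} \<rightarrow> K \<noteq> {}" using K by auto
  have bdd: "bdd_below (R ` prob_measures_on K)" "bdd_below (?E ` ({..<N} \<rightarrow> K))"
    using risk_nonneg by (auto simp: N_head_risk_def intro!: bdd_belowI2[of _ 0])
  have ne': "prob_measures_on K \<noteq> {}"
    using ne empirical_measure_in_prob_measures_on[OF _ N] by blast
  have "(INF \<rho> \<in> prob_measures_on K. R \<rho>) \<le> (INF w \<in> {..<N} \<rightarrow> K. ?E w)"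
    using ne bdd empirical_measure_in_prob_measures_on[OF _ N]
    by (intro cINF_greatest) (auto simp: N_head_risk_def intro!: cINF_lower)
  then show "0 \<le> (INF w \<in> {..<N} \<rightarrow> K. ?E w) - (INF \<rho> \<in> prob_measures_on K. R \<rho>)"
    by simp
  \<comment> \<open>In this form each \<rho> is treated separately by its own heads, so no
    minimising measure has to be produced.\<close>
  have "(INF w \<in> {..<N} \<rightarrow> K. ?E w) - 2 * b / sqrt (real N) \<le> (INF \<rho> \<in> prob_measures_on K. R \<rho>)"
  proof (rule cINF_greatest[OF ne'])
    fix \<rho> assume "\<rho> \<in> prob_measures_on K"
    then obtain w where "w \<in> {..<N} \<rightarrow> K" "?E w \<le> R \<rho> + 2 * b / sqrt (real N)"
      using exists_heads_near_risk N by blast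
    then show "(INF w \<in> {..<N} \<rightarrow> K. ?E w) - 2 * b / sqrt (real N) \<le> R \<rho>"
      using cINF_lower[OF bdd(2), of w] by linarith
  qed
  then show "(INF w \<in> {..<N} \<rightarrow> K. ?E w) - (INF \<rho> \<in> prob_measures_on K. R \<rho>) \<le> 2 * b / sqrt (real N)"
    by simp
qed

end

section \<open>From the smoothness assumption to the theorem\<close>

text \<open>The order zero term is the norm of the output, and it is at most the whole sum because
  the other terms are nonnegative. Replacing \<open>B\<close> by \<open>\<bar>B\<bar> + 1\<close>
  gives a positive bound for every real \<open>B\<close>.\<close>

lemma smoothness_assumption_head_bound:
  assumes "smoothness_assumption L dx dk dv Wout K Kx \<mu> B"
    and "X \<in> PiE {..<L} (\<lambda>_. Kx)" "l < L" "w \<in> K"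
  shows "(\<Sum>j<dv. (head_output L dx dk Wout l X w $ j)\<^sup>2) \<le> (\<bar>B\<bar> + 1)\<^sup>2"
proof -
  let ?D = "\<lambda>k. deriv_norm k (param_dim dx dk) dv (head_output L dx dk Wout l X) w"
  have "?D 0 \<le> (\<Sum>k\<le>3. ?D k)"
    using sum_mono2[of "{..3::nat}" "{0}" ?D] by (simp add: deriv_norm_nonneg)
  also have "\<dots> \<le> ereal B"
    using assms by (auto simp: smoothness_assumption_def)
  finally have "L2_set (\<lambda>j. head_output L dx dk Wout l X w $ j) {..<dv} \<le> \<bar>B\<bar> + 1"
    by (simp add: deriv_norm_0)
  from power_mono[OF this L2_set_nonneg, of 2] show ?thesis
    by (simp add: L2_set_def sum_nonneg)
qed

theorem theorem4p1:
  fixes B :: real and L :: nat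
  assumes "L \<ge> 1"
  shows "\<exists>C::real. \<forall>(dx::nat) (dk::nat) (dv::nat) (Wout :: real mat)
      (K :: (nat \<Rightarrow> real) set) (Kx :: (nat \<Rightarrow> real) set)
      (\<mu> :: (nat \<Rightarrow> nat \<Rightarrow> real) measure) (Y :: nat \<Rightarrow> (nat \<Rightarrow> nat \<Rightarrow> real) \<Rightarrow> real vec).
    dx \<ge> 1 \<longrightarrow> dk \<ge> 1 \<longrightarrow> dv \<ge> 1 \<longrightarrow> Wout \<in> carrier_mat dx dv \<longrightarrow>
    data_model L dv Kx \<mu> Y \<longrightarrow>
    smoothness_assumption L dx dk dv Wout K Kx \<mu> B \<longrightarrow>
    (\<forall>N::nat. N \<ge> 1 \<longrightarrow>
      0 \<le> (INF w \<in> {..<N} \<rightarrow> K. N_head_risk L dx dk dv Wout \<mu> Y K N w)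
          - (INF \<rho> \<in> prob_measures_on K. risk L dx dk dv Wout \<mu> Y \<rho>) \<and>
      (INF w \<in> {..<N} \<rightarrow> K. N_head_risk L dx dk dv Wout \<mu> Y K N w)
          - (INF \<rho> \<in> prob_measures_on K. risk L dx dk dv Wout \<mu> Y \<rho>) \<le> C / sqrt (real N))"
\<comment> \<open>The constant is \<open>2 * b\<close> for \<open>b = \<bar>B\<bar> + 1\<close>,
  fixed before the dimensions, the sets and the data are introduced.\<close>
proof (intro exI[of _ "2 * (\<bar>B\<bar> + 1)"] allI impI)
  fix dx dk dv N :: nat and Wout K Kx \<mu> Y
  assume Wout: "Wout \<in> carrier_mat dx dv" and data: "data_model L dv Kx \<mu> Y"
    and smooth: "smoothness_assumption L dx dk dv Wout K Kx \<mu> B" and N: "1 \<le> N"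
  interpret attention_setting L dx dk dv Wout K Kx \<mu> Y "\<bar>B\<bar> + 1"
    using assms Wout data smoothness_assumption_head_bound[OF smooth] by unfold_locales auto
  let ?gap = "(INF w \<in> {..<N} \<rightarrow> K. N_head_risk L dx dk dv Wout \<mu> Y K N w)
      - (INF \<rho> \<in> prob_measures_on K. risk L dx dk dv Wout \<mu> Y \<rho>)"
  show "0 \<le> ?gap \<and> ?gap \<le> 2 * (\<bar>B\<bar> + 1) / sqrt (real N)"
  proof (cases "K = {}")
    case False
    then show ?thesis using risk_gap[OF N] by blast
  next
    case True
    \<comment> \<open>Both infima are the unspecified real \<open>Inf {}\<close>, and cancel.\<close>
    have "prob_measures_on K = {}"
      using prob_space.not_empty prob_measures_onD(1,3) True by blast
    moreover have "{..<N} \<rightarrow> K = {}"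
      using True N by (auto simp: Pi_def intro: exI[of _ 0])
    ultimately have "?gap = 0"
      by (simp only: image_empty diff_self)
    then show ?thesis by simp
  qed
qed

end
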